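(* Let $X=(V_X,E_X)$ and $Y=(V_Y,E_Y)$ be connected graphs with the graph metric. Suppose $X$ and $Y$ are quasi-isometric, have bounded degree, and satisfy linear isoperimetric inequalities. Then the vertex sets $V_X$ and $V_Y$ (with the restricted metrics) are bilipschitz equivalent. Moreover, if $f\colon X\to Y$ is a quasi-isometry, then there is a bilipschitz equivalence $g\colon V_X\to V_Y$ within bounded distance of $f|_{V_X}$, i.e. $\sup_{v\in V_X} d_Y(g(v),f(v))<\infty$.
   Context: Graph metric: a connected graph $X=(V_X,E_X)$ is viewed as a metric space by taking each edge to be isometric to an interval of length $1$ and using the induced path metric $d_X$. In particular, for $x,x'\in V_X$, $d_X(x,x')$ is the fewest number of edges required to connect $x$ to $x'$. Bounded degree: there is $\mu>0$ such that every vertex $v$ has $\deg(v)\le\mu$, where $\deg(v)$ is the number of edges emanating from $v$. Linear isoperimetric inequality: for $A\subseteq V_X$ put $\partial A=\{x\in V_X: x\notin A \text{ and } d_X(x,A)\le 1\}$. The graph $X$ satisfies a linear isoperimetric inequality if there is a constant $C>0$ such that $|A|\le C|\partial A|$ for all finite $A\subseteq V_X$, where $|\cdot|$ denotes cardinality. Quasi-isometry: a map $f\colon (X,d_X)\to(Y,d_Y)$ between metric spaces (not necessarily continuous) is a quasi-isometry if there are constants $C,D>0$ such that for all $x,x'\in X$ $$\frac1C d_X(x,x')-D\le d_Y(f(x),f(x'))\le C d_X(x,x')+D,$$ and every point of $Y$ is within distance $C$ of $f(X)$. Two spaces are quasi-isometric if there is a quasi-isometry from one to the other. Bilipschitz equivalence: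 a bijection $g\colon (X,d_X)\to(Y,d_Y)$ between metric spaces for which there is $C>0$ with $\frac1C d_X(x,x')\le d_Y(g(x),g(x'))\le C d_X(x,x')$ for all $x,x'\in X$. Two spaces are bilipschitz equivalent if such a bijection exists. *)

theory Defs
  imports "HOL-Analysis.Analysis" "Graph_Theory.Digraph_Component"
begin

section \<open>Quasi-isometries and bilipschitz equivalences\<close>

definition quasi_isometry :: "'a metric \<Rightarrow> 'b metric \<Rightarrow> ('a \<Rightarrow> 'b) \<Rightarrow> bool" where
  "quasi_isometry m m' f \<longleftrightarrow>
     f \<in> mspace m \<rightarrow> mspace m' \<and>
     (\<exists>C D. C > 0 \<and> D > 0 \<and>
        (\<forall>x\<in>mspace m. \<forall>x'\<in>mspace m.
           1 / C * mdist m x x' - D \<le> mdist m' (f x) (f x') \<and>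
           mdist m' (f x) (f x') \<le> C * mdist m x x' + D) \<and>
        (\<forall>y\<in>mspace m'. \<exists>x\<in>mspace m. mdist m' y (f x) \<le> C))"

definition quasi_isometric :: "'a metric \<Rightarrow> 'b metric \<Rightarrow> bool" where
  "quasi_isometric m m' \<longleftrightarrow> (\<exists>f. quasi_isometry m m' f)"

definition bilipschitz_equivalence :: "'a metric \<Rightarrow> 'b metric \<Rightarrow> ('a \<Rightarrow> 'b) \<Rightarrow> bool" where
  "bilipschitz_equivalence m m' g \<longleftrightarrow>
     bij_betw g (mspace m) (mspace m') \<and>
     (\<exists>C>0. \<forall>x\<in>mspace m. \<forall>x'\<in>mspace m.
        1 / C * mdist m x x' \<le> mdist m' (g x) (g x') \<and>
        mdist m' (g x) (g x') \<le> C * mdist m x x')"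

definition bilipschitz_equivalent :: "'a metric \<Rightarrow> 'b metric \<Rightarrow> bool" where
  "bilipschitz_equivalent m m' \<longleftrightarrow> (\<exists>g. bilipschitz_equivalence m m' g)"


section \<open>Graphs as metric spaces\<close>

text \<open>
  An undirected graph, possibly infinite and possibly with loops and parallel edges, is
  given by a \<^locale>\<open>wf_digraph\<close> whose arcs are its edges, each listed once with an
  arbitrary orientation. The orientation only serves to parametrise the edge by the unit
  interval; no notion below depends on it.

  The points of the geometric realisation are the vertices and the interior points of the
  edges, \<open>Inner e t\<close> lying at distance \<open>t\<close> along \<open>e\<close> from its tail.
\<close>

datatype ('v, 'e) point = Vertex 'v | Inner 'e real

definition vertex_points :: "('v, 'e) pre_digraph \<Rightarrow> ('v, 'e) point set" where
  "vertex_points G = Vertex ` verts G"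

definition points :: "('v, 'e) pre_digraph \<Rightarrow> ('v, 'e) point set" where
  "points G = vertex_points G \<union> {Inner e t | e t. e \<in> arcs G \<and> 0 < t \<and> t < 1}"

definition edge_point :: "('v, 'e) pre_digraph \<Rightarrow> 'e \<Rightarrow> real \<Rightarrow> ('v, 'e) point" where
  "edge_point G e t =
     (if t = 0 then Vertex (tail G e) else if t = 1 then Vertex (head G e) else Inner e t)"

text \<open>
  \<open>path_of_length G p q l\<close>: there is a path from \<open>p\<close> to \<open>q\<close> of length \<open>l\<close> that
  is a finite concatenation of segments, each running inside a single edge.
\<close>

inductive path_of_length ::
  "('v, 'e) pre_digraph \<Rightarrow> ('v, 'e) point \<Rightarrow> ('v, 'e) point \<Rightarrow> real \<Rightarrow> bool" for G where
  refl: "p \<in> points G \<Longrightarrow> path_of_length G p p 0"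
| step: "path_of_length G p (edge_point G e s) l \<Longrightarrow> e \<in> arcs G \<Longrightarrow>
         s \<in> {0..1} \<Longrightarrow> t \<in> {0..1} \<Longrightarrow> path_of_length G p (edge_point G e t) (l + \<bar>s - t\<bar>)"

text \<open>
  The value \<open>0\<close> off the carrier is there because \<^locale>\<open>Metric_space\<close> asks for a
  nonnegative symmetric function on the whole type.
\<close>

definition path_dist :: "('v, 'e) pre_digraph \<Rightarrow> ('v, 'e) point \<Rightarrow> ('v, 'e) point \<Rightarrow> real" where
  "path_dist G p q =
     (if p \<in> points G \<and> q \<in> points G then Inf {l. path_of_length G p q l} else 0)"

definition graph_metric :: "('v, 'e) pre_digraph \<Rightarrow> ('v, 'e) point metric" where
  "graph_metric G = metric (points G, path_dist G)"

definition vertex_metric :: "('v, 'e) pre_digraph \<Rightarrow> ('v, 'e) point metric" where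
  "vertex_metric G = submetric (graph_metric G) (vertex_points G)"

text \<open>
  \<^const>\<open>Digraph_Component.connected\<close> refers to the underlying undirected graph and
  includes that there is at least one vertex.
\<close>

definition connected_graph :: "('v, 'e) pre_digraph \<Rightarrow> bool" where
  "connected_graph G \<longleftrightarrow> wf_digraph G \<and> Digraph_Component.connected G"


section \<open>Bounded degree and linear isoperimetric inequality\<close>

text \<open>A loop is counted once; finiteness is stated because \<^const>\<open>card\<close> is \<open>0\<close> on infinite sets.\<close>

definition bounded_degree :: "('v, 'e) pre_digraph \<Rightarrow> bool" where
  "bounded_degree G \<longleftrightarrow>
     (\<exists>\<mu>::real. \<mu> > 0 \<and> (\<forall>v\<in>verts G.
        finite {e \<in> arcs G. tail G e = v \<or> head G e = v} \<and>
        card {e \<in> arcs G. tail G e = v \<or> head G e = v} \<le> \<mu>))"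

text \<open>
  The distance to a set is an infimum in \<^typ>\<open>ereal\<close>, so that it is \<open>\<infinity>\<close> for the empty set.
\<close>

definition boundary :: "('v, 'e) pre_digraph \<Rightarrow> ('v, 'e) point set \<Rightarrow> ('v, 'e) point set" where
  "boundary G A = {x \<in> vertex_points G.
     x \<notin> A \<and> (INF a\<in>A. ereal (mdist (graph_metric G) x a)) \<le> 1}"

text \<open>
  An infinite boundary satisfies the inequality; \<^const>\<open>card\<close> would count it as \<open>0\<close>.
\<close>

definition linear_isoperimetric :: "('v, 'e) pre_digraph \<Rightarrow> bool" where
  "linear_isoperimetric G \<longleftrightarrow>
     (\<exists>C::real. C > 0 \<and> (\<forall>A. A \<subseteq> vertex_points G \<and> finite A \<and> finite (boundary G A) \<longrightarrow>
        card A \<le> C * card (boundary G A)))"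


section \<open>The path distance is a metric and is the edge distance on vertices\<close>

lemma edge_point_in_points:
  assumes "wf_digraph G" "e \<in> arcs G" "t \<in> {0..1}"
  shows "edge_point G e t \<in> points G"
  using assms wf_digraph.tail_in_verts[of G e] wf_digraph.head_in_verts[of G e]
  by (auto simp: edge_point_def points_def vertex_points_def)

lemma path_of_length_nonneg: "path_of_length G p q l \<Longrightarrow> 0 \<le> l"
  by (induction rule: path_of_length.induct) auto

lemma path_of_length_points:
  assumes "wf_digraph G" "path_of_length G p q l"
  shows "p \<in> points G \<and> q \<in> points G"
  using assms(2) by induction (auto simp: edge_point_in_points[OF assms(1)])

lemma path_of_length_trans:
  assumes "path_of_length G q r l'" "path_of_length G p q l"
  shows "path_of_length G p r (l + l')"
  using assms
proof (induction arbitrary: l rule: path_of_length.induct)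
  case (step q e s l' t)
  then show ?case
    using path_of_length.step[of G p e s "l + l'" t] by (simp add: add.assoc)
qed simp

lemma path_of_length_segment:
  assumes "wf_digraph G" "e \<in> arcs G" "s \<in> {0..1}" "t \<in> {0..1}"
  shows "path_of_length G (edge_point G e s) (edge_point G e t) \<bar>s - t\<bar>"
  using path_of_length.step[OF path_of_length.refl[OF edge_point_in_points[OF assms(1-3)]] assms(2-4)]
  by simp

lemma path_of_length_sym:
  assumes "wf_digraph G" "path_of_length G p q l"
  shows "path_of_length G q p l"
  using assms(2)
proof (induction rule: path_of_length.induct)
  case (refl p)
  then show ?case by (rule path_of_length.refl)
next
  case (step p e s l t)
  then have "path_of_length G (edge_point G e t) (edge_point G e s) \<bar>t - s\<bar>"
    by (intro path_of_length_segment assms) auto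
  from path_of_length_trans[OF step.IH this] show ?case
    by (simp add: add.commute abs_minus_commute)
qed

lemma points_cases:
  assumes "p \<in> points G"
  obtains v where "v \<in> verts G" "p = Vertex v"
  | e t where "e \<in> arcs G" "0 < t" "t < 1" "p = edge_point G e t" "p = Inner e t"
  using assms by (auto simp: points_def vertex_points_def edge_point_def)

lemma lipschitz_path:
  assumes "\<And>e s t. e \<in> arcs G \<Longrightarrow> s \<in> {0..1} \<Longrightarrow> t \<in> {0..1} \<Longrightarrow>
             \<bar>h (edge_point G e s) - h (edge_point G e t)\<bar> \<le> \<bar>s - t\<bar>"
    and "path_of_length G p q l"
  shows "\<bar>h p - h q\<bar> \<le> (l::real)"
  using assms(2)
proof (induction rule: path_of_length.induct)
  case (step p e s l t)
  then show ?case using assms(1)[of e s t] by linarith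
qed simp

abbreviation adj :: "('v, 'e) pre_digraph \<Rightarrow> ('v \<times> 'v) set" where
  "adj G \<equiv> parcs (mk_symmetric G)"

lemma adj_path:
  assumes "wf_digraph G" "(u, v) \<in> adj G"
  shows "path_of_length G (Vertex u) (Vertex v) 1"
proof -
  obtain e where e: "e \<in> arcs G" "(u, v) = (tail G e, head G e) \<or> (u, v) = (head G e, tail G e)"
    using assms(2) by (auto simp: parcs_mk_symmetric)
  have *: "path_of_length G (Vertex (tail G e)) (Vertex (head G e)) 1"
    using path_of_length_segment[OF assms(1) e(1), of 0 1] by (simp add: edge_point_def)
  show ?thesis using e(2) * path_of_length_sym[OF assms(1) *] by auto
qed

lemma relpow_path:
  assumes "wf_digraph G" "u \<in> verts G" "(u, v) \<in> adj G ^^ n"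
  shows "path_of_length G (Vertex u) (Vertex v) (real n)"
  using assms(3)
proof (induction n arbitrary: v)
  case 0
  then show ?case
    using assms(2) by (auto intro!: path_of_length.refl simp: points_def vertex_points_def)
next
  case (Suc n)
  then obtain w where "(u, w) \<in> adj G ^^ n" "(w, v) \<in> adj G" by auto
  then show ?case
    using path_of_length_trans[OF adj_path[OF assms(1)] Suc.IH] by (simp add: add.commute)
qed

lemma connected_graph_relpow:
  assumes "connected_graph G" "u \<in> verts G" "v \<in> verts G"
  shows "\<exists>n. (u, v) \<in> adj G ^^ n"
proof -
  have "u \<rightarrow>\<^sup>*\<^bsub>mk_symmetric G\<^esub> v"
    using assms by (auto simp: connected_graph_def Digraph_Component.connected_def
        strongly_connected_def)
  then have "(u, v) \<in> (adj G)\<^sup>*"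
    by (auto simp: reachable_def dest: rtrancl_on_rtranclI)
  then show ?thesis by (simp add: rtrancl_power)
qed

lemma path_exists_from_vertex:
  assumes "connected_graph G" "p \<in> points G"
  shows "\<exists>v l. v \<in> verts G \<and> path_of_length G (Vertex v) p l"
  using assms(2)
proof (cases rule: points_cases)
  case (1 v)
  then show ?thesis using assms(2) path_of_length.refl by fastforce
next
  case (2 e t)
  have wf: "wf_digraph G" using assms(1) by (simp add: connected_graph_def)
  have "path_of_length G (edge_point G e 0) p \<bar>0 - t\<bar>"
    unfolding 2(4) using 2 by (intro path_of_length_segment wf) auto
  then show ?thesis using wf_digraph.tail_in_verts[OF wf 2(1)] by (auto simp: edge_point_def)
qed

lemma path_exists:
  assumes "connected_graph G" "p \<in> points G" "q \<in> points G"
  shows "\<exists>l. path_of_length G p q l"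
proof -
  have wf: "wf_digraph G" using assms(1) by (simp add: connected_graph_def)
  obtain u a where u: "u \<in> verts G" "path_of_length G (Vertex u) p a"
    using path_exists_from_vertex[OF assms(1,2)] by auto
  obtain v b where v: "v \<in> verts G" "path_of_length G (Vertex v) q b"
    using path_exists_from_vertex[OF assms(1,3)] by auto
  obtain n where "(u, v) \<in> adj G ^^ n" using connected_graph_relpow[OF assms(1) u(1) v(1)] ..
  then have "path_of_length G (Vertex u) (Vertex v) n" by (rule relpow_path[OF wf u(1)])
  from path_of_length_trans[OF path_of_length_trans[OF v(2) this] path_of_length_sym[OF wf u(2)]]
  show ?thesis ..
qed

lemma path_lengths_bdd_below: "bdd_below {l. path_of_length G p q l}"
  by (rule bdd_belowI[of _ 0]) (auto dest: path_of_length_nonneg)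

lemma path_dist_le:
  assumes "wf_digraph G" "path_of_length G p q l"
  shows "path_dist G p q \<le> l"
  using path_of_length_points[OF assms] assms(2)
  by (auto simp: path_dist_def intro: cInf_lower path_lengths_bdd_below)

lemma path_dist_ge:
  assumes "connected_graph G" "p \<in> points G" "q \<in> points G"
    and "\<And>l. path_of_length G p q l \<Longrightarrow> c \<le> l"
  shows "c \<le> path_dist G p q"
  using path_exists[OF assms(1-3)] assms(2-4) by (auto simp: path_dist_def intro!: cInf_greatest)

definition edge_dist :: "('v, 'e) pre_digraph \<Rightarrow> 'v \<Rightarrow> 'v \<Rightarrow> nat" where
  "edge_dist G u v = (LEAST n. (u, v) \<in> adj G ^^ n)"

lemma edge_dist_relpow:
  assumes "connected_graph G" "u \<in> verts G" "v \<in> verts G"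
  shows "(u, v) \<in> adj G ^^ edge_dist G u v"
  unfolding edge_dist_def using connected_graph_relpow[OF assms] by (rule LeastI_ex)

lemma edge_dist_step:
  assumes "connected_graph G" "u \<in> verts G" "v \<in> verts G" "(v, w) \<in> adj G"
  shows "edge_dist G u w \<le> Suc (edge_dist G u v)"
  unfolding edge_dist_def[of G u w]
  using edge_dist_relpow[OF assms(1-3)] assms(4) by (intro Least_le) auto

lemma min_lipschitz:
  fixes a b s t :: real
  shows "\<bar>min (s + a) (1 - s + b) - min (t + a) (1 - t + b)\<bar> \<le> \<bar>s - t\<bar>"
  by (auto simp: min_def abs_if)

lemma path_dist_Vertex:
  assumes "connected_graph G" "u \<in> verts G" "v \<in> verts G"
  shows "path_dist G (Vertex u) (Vertex v) = edge_dist G u v"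
proof (rule antisym)
  have wf: "wf_digraph G" using assms(1) by (simp add: connected_graph_def)
  show "path_dist G (Vertex u) (Vertex v) \<le> edge_dist G u v"
    by (intro path_dist_le wf relpow_path assms edge_dist_relpow)
  define k where "k w = real (edge_dist G u w)" for w
  define h where "h p = (case p of Vertex w \<Rightarrow> k w
      | Inner e s \<Rightarrow> min (s + k (tail G e)) (1 - s + k (head G e)))" for p
  have h_edge: "h (edge_point G e s) = min (s + k (tail G e)) (1 - s + k (head G e))"
    if "e \<in> arcs G" "s \<in> {0..1}" for e s
  proof -
    have "(tail G e, head G e) \<in> adj G" "(head G e, tail G e) \<in> adj G"
      using that by (auto simp: parcs_mk_symmetric)
    then have "k (head G e) \<le> 1 + k (tail G e)" "k (tail G e) \<le> 1 + k (head G e)"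
      using edge_dist_step[OF assms(1,2)] wf_digraph.wellformed[OF wf that(1)]
      unfolding k_def by fastforce+
    then show ?thesis by (auto simp: h_def edge_point_def)
  qed
  show "edge_dist G u v \<le> path_dist G (Vertex u) (Vertex v)"
  proof (rule path_dist_ge[OF assms(1)])
    fix l assume "path_of_length G (Vertex u) (Vertex v) l"
    then have "\<bar>h (Vertex u) - h (Vertex v)\<bar> \<le> l"
      by (rule lipschitz_path[rotated]) (simp only: h_edge min_lipschitz)
    moreover have "edge_dist G u u = 0" by (auto simp: edge_dist_def intro: Least_eq_0)
    ultimately show "edge_dist G u v \<le> l" by (simp add: h_def k_def)
  qed (use assms in \<open>auto simp: points_def vertex_points_def\<close>)
qed

lemma path_dist_Inner_pos:
  assumes "connected_graph G" "p \<in> points G" "q \<in> points G" "p = Inner e t" "p \<noteq> q"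
  shows "0 < path_dist G p q"
proof -
  have t: "0 < t" "t < 1" using assms(2,4) by (auto simp: points_def vertex_points_def)
  define h where "h x = (case x of Vertex w \<Rightarrow> min t (1 - t)
      | Inner e' s \<Rightarrow> if e' = e then min \<bar>s - t\<bar> (min t (1 - t)) else min t (1 - t))" for x :: "('a, 'b) point"
  have h_edge: "h (edge_point G e' s) =
      (if e' = e then min \<bar>s - t\<bar> (min t (1 - t)) else min t (1 - t))"
    if "s \<in> {0..1}" for e' s
    using that t by (auto simp: h_def edge_point_def)
  have "h q > 0" "h p = 0"
    using assms(4,5) t by (auto simp: h_def split: point.splits)
  have "h q \<le> path_dist G p q"
  proof (rule path_dist_ge[OF assms(1-3)])
    fix l assume "path_of_length G p q l"
    then have "\<bar>h p - h q\<bar> \<le> l"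
      by (rule lipschitz_path[rotated]) (auto simp: h_edge min_def abs_if)
    then show "h q \<le> l" using \<open>h p = 0\<close> by simp
  qed
  then show ?thesis using \<open>h q > 0\<close> by simp
qed

theorem Metric_space_path_dist:
  assumes "connected_graph G"
  shows "Metric_space (points G) (path_dist G)"
proof
  have wf: "wf_digraph G" using assms by (simp add: connected_graph_def)
  show nonneg: "0 \<le> path_dist G p q" for p q
  proof (cases "p \<in> points G \<and> q \<in> points G")
    case True
    then show ?thesis by (intro path_dist_ge[OF assms]) (auto dest: path_of_length_nonneg)
  qed (auto simp: path_dist_def)
  show sym: "path_dist G p q = path_dist G q p" for p q
  proof -
    have "{l. path_of_length G p q l} = {l. path_of_length G q p l}"
      using path_of_length_sym[OF wf] by blast
    then show ?thesis by (simp add: path_dist_def)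
  qed
  show "path_dist G p q = 0 \<longleftrightarrow> p = q" if pq: "p \<in> points G" "q \<in> points G" for p q
  proof
    assume 0: "path_dist G p q = 0"
    show "p = q"
    proof (rule ccontr)
      assume "p \<noteq> q"
      then have nI: "p \<noteq> Inner e t" "q \<noteq> Inner e t" for e t
        using path_dist_Inner_pos[OF assms pq] path_dist_Inner_pos[OF assms pq(2,1)] 0 sym[of p q]
        by fastforce+
      obtain u v where uv: "u \<in> verts G" "v \<in> verts G" "p = Vertex u" "q = Vertex v"
        using pq nI by (auto simp: points_def vertex_points_def)
      with 0 have "edge_dist G u v = 0" using path_dist_Vertex[OF assms] by simp
      with edge_dist_relpow[OF assms uv(1,2)] have "u = v" by simp
      with uv \<open>p \<noteq> q\<close> show False by simp
    qed
  next
    assume "p = q"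
    then show "path_dist G p q = 0"
      using path_dist_le[OF wf path_of_length.refl[OF pq(1)]] nonneg[of p q] by simp
  qed
  show "path_dist G p r \<le> path_dist G p q + path_dist G q r"
    if pqr: "p \<in> points G" "q \<in> points G" "r \<in> points G" for p q r
  proof -
    have "path_dist G p r - l \<le> path_dist G q r" if l: "path_of_length G p q l" for l
    proof (rule path_dist_ge[OF assms pqr(2,3)])
      fix l' assume "path_of_length G q r l'"
      from path_dist_le[OF wf path_of_length_trans[OF this l]]
      show "path_dist G p r - l \<le> l'" by simp
    qed
    then have "path_dist G p r - path_dist G q r \<le> path_dist G p q"
      by (intro path_dist_ge[OF assms pqr(1,2)]) (simp add: algebra_simps)
    then show ?thesis by simp
  qed
qed

lemma mspace_graph_metric [simp]: "connected_graph G \<Longrightarrow> mspace (graph_metric G) = points G"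
  by (simp add: graph_metric_def Metric_space.mspace_metric[OF Metric_space_path_dist])

lemma mdist_graph_metric [simp]: "connected_graph G \<Longrightarrow> mdist (graph_metric G) = path_dist G"
  by (simp add: graph_metric_def Metric_space.mdist_metric[OF Metric_space_path_dist])

lemma mspace_vertex_metric [simp]:
  "connected_graph G \<Longrightarrow> mspace (vertex_metric G) = vertex_points G"
  by (auto simp: vertex_metric_def points_def)

lemma mdist_vertex_metric [simp]: "connected_graph G \<Longrightarrow> mdist (vertex_metric G) = path_dist G"
  by (simp add: vertex_metric_def)

end

theory Submission
  imports Defs
begin

text \<open>
  A linear isoperimetric inequality makes sets grow exponentially: passing from a finite set of
  vertices to its 1-neighbourhood multiplies the cardinality by at least \<open>1 + 1 / C\<close>, so the
  \<open>n\<close>-neighbourhood of \<open>A\<close> has at least \<open>(1 + 1 / C) ^ n * card A\<close> elements. For every factor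
  \<open>k\<close> there is hence a radius at which neighbourhoods are \<open>k\<close> times as large as the set
  (\<open>uniformly_expanding_vertex_metric\<close>). This beats any bounded loss of cardinality, and a
  quasi-isometry \<open>f\<close> between graphs of bounded degree, moved to the nearest vertices, loses only a
  bounded factor: its fibres lie in balls of a fixed radius.

  So in the bipartite graph in which a vertex \<open>x\<close> of \<open>X\<close> is joined to all vertices of \<open>Y\<close> within a
  large distance of \<open>f x\<close>, Hall's condition holds, and Hall's theorem for infinite, locally finite
  graphs (\<open>Hall_locally_finite\<close>) gives an injection \<open>i\<close> of the vertices of \<open>X\<close> into those of
  \<open>Y\<close> at bounded distance from \<open>f\<close>. The same argument for a coarse inverse of \<open>f\<close> gives an
  injection \<open>j\<close> backwards with \<open>f \<circ> j\<close> at bounded distance from the identity. The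
  Schroeder-Bernstein construction glues \<open>i\<close> and the inverse of \<open>j\<close> to a bijection, which is
  still at bounded distance from \<open>f\<close> because each of its values comes from one of the two
  (\<open>bijection_near_quasi_isometry\<close>).

  A bijection near a quasi-isometry is a quasi-isometry, and since different vertices are at
  distance at least 1, its additive constant can be absorbed into the multiplicative one
  (\<open>bilipschitz_equivalence_if_near_quasi_isometry\<close>).
\<close>

section \<open>Matchings in infinite bipartite graphs\<close>

text \<open>
  Rado's argument, which covers finite and infinite index sets alike. Remove from \<open>R\<close> as many pairs
  as possible while keeping Hall's condition; since only finitely many pairs matter for a finite
  \<open>A\<close>, the condition survives unions of chains, and Zorn's lemma yields a maximal removal. What
  remains is single-valued: if \<open>i\<close> still had two partners \<open>x\<close> and \<open>y\<close>, removing either would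
  violate the condition on some finite sets \<open>A\<close> and \<open>B\<close> containing \<open>i\<close>, which submodularity of
  \<open>card\<close> rules out. A single-valued relation satisfying Hall's condition is injective.
\<close>

theorem Hall_locally_finite:
  fixes R :: "('a \<times> 'b) set"
  assumes fin: "\<And>x. x \<in> I \<Longrightarrow> finite (R `` {x})"
    and Hall: "\<And>A. A \<subseteq> I \<Longrightarrow> finite A \<Longrightarrow> card A \<le> card (R `` A)"
  obtains g where "inj_on g I" "\<And>x. x \<in> I \<Longrightarrow> (x, g x) \<in> R"
proof -
  define \<D> where "\<D> = {D. \<forall>A\<subseteq>I. finite A \<longrightarrow> card A \<le> card ((R - D) `` A)}"
  have "\<exists>M\<in>\<D>. \<forall>D\<in>\<D>. M \<subseteq> D \<longrightarrow> D = M"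
  proof (rule subset_Zorn_nonempty)
    show "\<D> \<noteq> {}" using Hall by (auto simp: \<D>_def intro!: exI[of _ "{}"])
    fix \<C> assume \<C>: "\<C> \<noteq> {}" "subset.chain \<D> \<C>"
    have "card A \<le> card ((R - \<Union>\<C>) `` A)" if A: "A \<subseteq> I" "finite A" for A
    proof -
      have "finite (\<Union>x\<in>A. {x} \<times> R `` {x})"
        using A fin by blast
      moreover have "R \<inter> (A \<times> UNIV) \<inter> \<Union>\<C> \<subseteq> (\<Union>x\<in>A. {x} \<times> R `` {x})" by auto
      ultimately have "finite (R \<inter> (A \<times> UNIV) \<inter> \<Union>\<C>)" by (rule rev_finite_subset)
      then obtain D where D: "D \<in> \<C>" "R \<inter> (A \<times> UNIV) \<inter> \<Union>\<C> \<subseteq> D"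
        using finite_subset_Union_chain[OF _ _ \<C>] by blast
      then have "(R - \<Union>\<C>) `` A = (R - D) `` A" by blast
      moreover have "D \<in> \<D>" using D(1) \<C>(2) by (auto simp: subset.chain_def)
      ultimately show ?thesis using A by (simp add: \<D>_def)
    qed
    then show "\<Union>\<C> \<in> \<D>" by (simp add: \<D>_def)
  qed
  then obtain M where M: "M \<in> \<D>" and max: "\<And>D. D \<in> \<D> \<Longrightarrow> M \<subseteq> D \<Longrightarrow> D = M" by blast
  define S where "S = R - M"
  have S: "card A \<le> card (S `` A)" if "A \<subseteq> I" "finite A" for A
    using M that by (simp add: \<D>_def S_def)
  have finS: "finite (T `` A)" if "A \<subseteq> I" "finite A" "T \<subseteq> S" for A T
  proof (rule finite_subset)
    show "T `` A \<subseteq> (\<Union>x\<in>A. R `` {x})" using that(3) by (auto simp: S_def)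
  qed (use that(1,2) fin in blast)
  have critical: "\<exists>A\<subseteq>I. finite A \<and> i \<in> A \<and> card ((S - {(i, x)}) `` A) < card A"
    if "(i, x) \<in> S" for i x
  proof -
    have "insert (i, x) M \<notin> \<D>" using max[of "insert (i, x) M"] that by (auto simp: S_def)
    moreover have "R - insert (i, x) M = S - {(i, x)}" by (auto simp: S_def)
    ultimately obtain A where A: "A \<subseteq> I" "finite A" "card ((S - {(i, x)}) `` A) < card A"
      by (auto simp: \<D>_def not_le)
    have "i \<in> A"
    proof (rule ccontr)
      assume "i \<notin> A"
      then have "(S - {(i, x)}) `` A = S `` A" by blast
      then show False using A(3) S[OF A(1,2)] by simp
    qed
    then show ?thesis using A by blast
  qed
  have unique: "x = y" if xy: "(i, x) \<in> S" "(i, y) \<in> S" for i x y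
  proof (rule ccontr)
    assume "x \<noteq> y"
    obtain A where A: "A \<subseteq> I" "finite A" "i \<in> A" "card ((S - {(i, x)}) `` A) < card A"
      using critical[OF xy(1)] by blast
    obtain B where B: "B \<subseteq> I" "finite B" "i \<in> B" "card ((S - {(i, y)}) `` B) < card B"
      using critical[OF xy(2)] by blast
    let ?P = "(S - {(i, x)}) `` A" and ?Q = "(S - {(i, y)}) `` B"
    have fin: "finite ?P" "finite ?Q" using A B by (auto intro!: finS)
    \<comment> \<open>Each of the two reduced relations lacks one pair at \<open>i\<close>, and the other one supplies it;
      in the intersection both pairs may be missing, so there \<open>i\<close> has to be left out.\<close>
    have "card (A \<union> B) \<le> card (S `` (A \<union> B))" using A B by (intro S) auto
    also have "\<dots> \<le> card (?P \<union> ?Q)"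
      using fin \<open>x \<noteq> y\<close> A(3) B(3) by (intro card_mono) auto
    finally have 1: "card (A \<union> B) \<le> card (?P \<union> ?Q)" .
    have "card (A \<inter> B - {i}) \<le> card (S `` (A \<inter> B - {i}))" using A B by (intro S) auto
    also have "\<dots> \<le> card (?P \<inter> ?Q)"
      using fin by (intro card_mono) auto
    finally have 2: "card (A \<inter> B) - 1 \<le> card (?P \<inter> ?Q)"
      using A B by simp
    have "card (?P \<union> ?Q) + card (?P \<inter> ?Q) = card ?P + card ?Q"
      "card (A \<union> B) + card (A \<inter> B) = card A + card B"
      using card_Un_Int[OF fin] card_Un_Int[OF A(2) B(2)] by simp_all
    then show False using 1 2 A(4) B(4) by linarith
  qed
  have "\<exists>y. (x, y) \<in> S" if "x \<in> I" for x
    using S[of "{x}"] that by (cases "S `` {x} = {}") auto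
  then obtain g where g: "\<And>x. x \<in> I \<Longrightarrow> (x, g x) \<in> S" by metis
  have "inj_on g I"
  proof (rule inj_onI, rule ccontr)
    fix x y assume xy: "x \<in> I" "y \<in> I" "g x = g y" "x \<noteq> y"
    have "S `` {x, y} \<subseteq> {g x}" using g[OF xy(1)] g[OF xy(2)] xy(3) unique by auto
    then have "card (S `` {x, y}) \<le> 1" using card_mono[of "{g x}"] by fastforce
    then show False using S[of "{x, y}"] xy by simp
  qed
  then show thesis using g that by (auto simp: S_def)
qed

text \<open>
  The bijection agrees at every point with \<open>i\<close> or with the inverse of \<open>j\<close>, so that any bound on
  how far \<open>i\<close> and \<open>j\<close> move points passes to it; equinumerosity alone would not give this.
\<close>

lemma Schroeder_Bernstein_pointwise:
  assumes i: "inj_on i A" "i ` A \<subseteq> B" and j: "inj_on j B" "j ` B \<subseteq> A"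
  obtains g where "bij_betw g A B" "\<And>x. x \<in> A \<Longrightarrow> g x = i x \<or> x = j (g x)"
proof -
  \<comment> \<open>\<open>X\<close> consists of the points whose chain of preimages under \<open>j\<close> and \<open>i\<close> stops in \<open>A\<close>.\<close>
  define X where "X = lfp (\<lambda>X. A - j ` (B - i ` X))"
  have X: "X = A - j ` (B - i ` X)"
    unfolding X_def by (rule lfp_unfold, rule monoI) blast
  define g where "g x = (if x \<in> X then i x else the_inv_into B j x)" for x
  have compl: "A - X = j ` (B - i ` X)" using X j(2) by blast
  have jg: "j (g x) = x" if "x \<in> A - X" for x
    using that j compl f_the_inv_into_f[OF j(1)] by (auto simp: g_def)
  have "bij_betw g X (i ` X)"
    using inj_on_subset[OF i(1), of X] X by (auto simp: bij_betw_def g_def inj_on_def)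
  moreover have "bij_betw g (A - X) (B - i ` X)"
    unfolding compl
  proof (rule bij_betw_byWitness[where f' = j])
    show "\<forall>x\<in>j ` (B - i ` X). j (g x) = x" using jg compl by blast
    have "g (j y) = y" if "y \<in> B - i ` X" for y
      using that compl the_inv_into_f_f[OF j(1)] by (auto simp: g_def)
    then show "\<forall>y\<in>B - i ` X. g (j y) = y" "g ` j ` (B - i ` X) \<subseteq> B - i ` X" by auto
  qed auto
  ultimately have "bij_betw g (X \<union> (A - X)) (i ` X \<union> (B - i ` X))"
    by (rule bij_betw_combine) auto
  moreover have "X \<union> (A - X) = A" "i ` X \<union> (B - i ` X) = B" using X i by auto
  moreover have "g x = i x \<or> x = j (g x)" if "x \<in> A" for x
    using jg[of x] that by (cases "x \<in> X") (auto simp: g_def)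
  ultimately show thesis using that by metis
qed


section \<open>Coarse geometry of discrete metric spaces\<close>

definition bounded_geometry :: "'a metric \<Rightarrow> bool" where
  "bounded_geometry m \<longleftrightarrow>
     (\<forall>r. \<exists>N. \<forall>x\<in>mspace m. finite (mcball_of m x r) \<and> card (mcball_of m x r) \<le> N)"

definition uniformly_discrete :: "'a metric \<Rightarrow> bool" where
  "uniformly_discrete m \<longleftrightarrow>
     (\<exists>\<epsilon>>0. \<forall>x\<in>mspace m. \<forall>y\<in>mspace m. x \<noteq> y \<longrightarrow> \<epsilon> \<le> mdist m x y)"

definition thickening :: "'a metric \<Rightarrow> real \<Rightarrow> 'a set \<Rightarrow> 'a set" where
  "thickening m r A = (\<Union>a\<in>A. mcball_of m a r)"

text \<open>
  Every factor \<open>k\<close> is attained, rather than some factor above 1, because the neighbourhoods have to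
  outgrow the size of the fibres of an arbitrary quasi-isometry.
\<close>

definition uniformly_expanding :: "'a metric \<Rightarrow> bool" where
  "uniformly_expanding m \<longleftrightarrow>
     (\<forall>k. \<exists>r. \<forall>A\<subseteq>mspace m. finite A \<longrightarrow> k * card A \<le> card (thickening m r A))"

lemma mdist_self: "x \<in> mspace m \<Longrightarrow> mdist m x x = 0"
  by simp

lemma in_thickening:
  "y \<in> thickening m r A \<longleftrightarrow> y \<in> mspace m \<and> (\<exists>a\<in>A. a \<in> mspace m \<and> mdist m a y \<le> r)"
  by (auto simp: thickening_def)

lemma finite_thickening:
  assumes "bounded_geometry m" "A \<subseteq> mspace m" "finite A"
  shows "finite (thickening m r A)"
  unfolding thickening_def
  using assms unfolding bounded_geometry_def by blast

lemma thickening_thickening_subset: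
  "thickening m s (thickening m r A) \<subseteq> thickening m (r + s) A"
proof
  fix y assume "y \<in> thickening m s (thickening m r A)"
  then obtain z a where *: "y \<in> mspace m" "z \<in> mspace m" "a \<in> A" "a \<in> mspace m"
    "mdist m a z \<le> r" "mdist m z y \<le> s"
    by (auto simp: in_thickening)
  then have "mdist m a y \<le> r + s" using mdist_triangle[of a m z y] by linarith
  then show "y \<in> thickening m (r + s) A" using * by (auto simp: in_thickening)
qed

text \<open>
  Growth by a fixed factor \<open>q > 1\<close> at one scale \<open>r\<close> suffices: iterating it multiplies the
  cardinality by powers of \<open>q\<close> while the scale only grows linearly. Bounded geometry keeps the
  successive neighbourhoods finite, so that the hypothesis applies to them again.
\<close>

lemma uniformly_expandingI:
  assumes bg: "bounded_geometry m" and "1 < q"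
    and step: "\<And>A. A \<subseteq> mspace m \<Longrightarrow> finite A \<Longrightarrow> q * real (card A) \<le> card (thickening m r A)"
  shows "uniformly_expanding m"
  unfolding uniformly_expanding_def
proof
  fix k :: nat
  have iterate: "q ^ n * card A \<le> card (thickening m (real (Suc n) * r) A)"
    if A: "A \<subseteq> mspace m" "finite A" for A n
  proof (induction n)
    case 0
    have "1 * real (card A) \<le> q * card A" using \<open>1 < q\<close> by (intro mult_right_mono) auto
    then show ?case using step[OF A] by simp
  next
    case (Suc n)
    let ?T = "thickening m (real (Suc n) * r) A"
    have "q ^ Suc n * card A \<le> q * card ?T"
      using Suc \<open>1 < q\<close> by (simp add: mult.assoc)
    also have "\<dots> \<le> card (thickening m r ?T)"
      using A bg by (intro step finite_thickening) (auto simp: in_thickening)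
    also have "\<dots> \<le> card (thickening m (real (Suc n) * r + r) A)"
      using A bg thickening_thickening_subset[of m r "real (Suc n) * r" A]
      by (intro of_nat_mono card_mono finite_thickening) auto
    also have "real (Suc n) * r + r = real (Suc (Suc n)) * r" by (simp add: algebra_simps)
    finally show ?case .
  qed
  obtain n where n: "real k < q ^ n" using real_arch_pow[OF \<open>1 < q\<close>] by blast
  have "k * card A \<le> card (thickening m (real (Suc n) * r) A)"
    if A: "A \<subseteq> mspace m" "finite A" for A
  proof -
    have "real k * card A \<le> q ^ n * card A" using n by (intro mult_right_mono) auto
    also have "\<dots> \<le> card (thickening m (real (Suc n) * r) A)" by (rule iterate[OF A])
    finally have "real (k * card A) \<le> real (card (thickening m (real (Suc n) * r) A))" by simp
    then show ?thesis by linarith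
  qed
  then show "\<exists>r. \<forall>A\<subseteq>mspace m. finite A \<longrightarrow> k * card A \<le> card (thickening m r A)" by blast
qed

lemma card_le_mult_card_image:
  assumes "finite A" "\<And>y. y \<in> h ` A \<Longrightarrow> card {x \<in> A. h x = y} \<le> N"
  shows "card A \<le> N * card (h ` A)"
proof -
  have "card A = (\<Sum>y\<in>h ` A. card {x \<in> A. h x = y})"
    using card_eq_sum sum.image_gen[OF assms(1), of "\<lambda>_. 1::nat" h] by simp
  also have "\<dots> \<le> (\<Sum>y\<in>h ` A. N)" by (intro sum_mono assms(2))
  finally show ?thesis by (simp add: mult.commute)
qed

text \<open>
  The fibres of \<open>h\<close> have at most \<open>N\<close> elements, hence \<open>h ` A\<close> has at least \<open>card A / N\<close>. At the
  scale \<open>r\<close> belonging to the factor \<open>N\<close> its neighbourhood has at least \<open>card A\<close> elements,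
  which is Hall's condition for choosing \<open>i x\<close> within \<open>r\<close> of \<open>h x\<close>.
\<close>

lemma injection_near_finite_to_one_map:
  assumes bg: "bounded_geometry m" and bg': "bounded_geometry m'"
    and ex: "uniformly_expanding m'"
    and h: "h ` mspace m \<subseteq> mspace m'"
    and fibre: "\<And>x x'. x \<in> mspace m \<Longrightarrow> x' \<in> mspace m \<Longrightarrow> h x = h x' \<Longrightarrow> mdist m x x' \<le> s"
  obtains i r where "inj_on i (mspace m)" "i ` mspace m \<subseteq> mspace m'"
    "\<And>x. x \<in> mspace m \<Longrightarrow> mdist m' (h x) (i x) \<le> r"
proof -
  obtain N where N: "\<And>x. x \<in> mspace m \<Longrightarrow> finite (mcball_of m x s) \<and> card (mcball_of m x s) \<le> N"
    using bg unfolding bounded_geometry_def by meson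
  obtain r where r: "\<And>A. A \<subseteq> mspace m' \<Longrightarrow> finite A \<Longrightarrow> N * card A \<le> card (thickening m' r A)"
    using ex unfolding uniformly_expanding_def by meson
  define R where "R = {(x, y). y \<in> mcball_of m' (h x) r}"
  have R_image: "R `` A = thickening m' r (h ` A)" for A
    by (auto simp: R_def thickening_def)
  obtain i where i: "inj_on i (mspace m)" "\<And>x. x \<in> mspace m \<Longrightarrow> (x, i x) \<in> R"
  proof (rule Hall_locally_finite)
    show "finite (R `` {x})" if "x \<in> mspace m" for x
      unfolding R_image using bg' h that by (intro finite_thickening) auto
    show "card A \<le> card (R `` A)" if A: "A \<subseteq> mspace m" "finite A" for A
    proof -
      have "card {x \<in> A. h x = y} \<le> N" if y: "y \<in> h ` A" for y
      proof -
        obtain a where a: "a \<in> A" "y = h a" using y by blast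
        have "mdist m a x \<le> s \<and> x \<in> mspace m" if "x \<in> A" "h x = y" for x
          using fibre[of a x] that a A(1) by auto
        then have "{x \<in> A. h x = y} \<subseteq> mcball_of m a s" using a A(1) by auto
        then show ?thesis using N[of a] a A card_mono by (meson le_trans subsetD)
      qed
      then have "card A \<le> N * card (h ` A)" by (rule card_le_mult_card_image[OF A(2)])
      also have "\<dots> \<le> card (R `` A)" unfolding R_image using A h by (intro r) auto
      finally show ?thesis .
    qed
  qed blast
  then show thesis using that[of i r] by (auto simp: R_def)
qed

lemma quasi_isometryE:
  assumes "quasi_isometry m m' f"
  obtains C D where "C > 0" "D > 0" "f ` mspace m \<subseteq> mspace m'"
    "\<And>x x'. x \<in> mspace m \<Longrightarrow> x' \<in> mspace m \<Longrightarrow> mdist m x x' \<le> C * (mdist m' (f x) (f x') + D)"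
    "\<And>x x'. x \<in> mspace m \<Longrightarrow> x' \<in> mspace m \<Longrightarrow> mdist m' (f x) (f x') \<le> C * mdist m x x' + D"
    "\<And>y. y \<in> mspace m' \<Longrightarrow> \<exists>x\<in>mspace m. mdist m' y (f x) \<le> C"
proof -
  obtain C D where *: "C > 0" "D > 0" "f ` mspace m \<subseteq> mspace m'"
    "\<And>x x'. x \<in> mspace m \<Longrightarrow> x' \<in> mspace m \<Longrightarrow> 1 / C * mdist m x x' - D \<le> mdist m' (f x) (f x')"
    "\<And>x x'. x \<in> mspace m \<Longrightarrow> x' \<in> mspace m \<Longrightarrow> mdist m' (f x) (f x') \<le> C * mdist m x x' + D"
    "\<And>y. y \<in> mspace m' \<Longrightarrow> \<exists>x\<in>mspace m. mdist m' y (f x) \<le> C"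
    using assms unfolding quasi_isometry_def by blast
  have "mdist m x x' \<le> C * (mdist m' (f x) (f x') + D)" if "x \<in> mspace m" "x' \<in> mspace m" for x x'
    using *(4)[OF that] *(1) by (simp add: field_simps)
  then show thesis using that * by blast
qed

text \<open>
  The two injections are obtained near \<open>f\<close> and near a coarse inverse \<open>h\<close> of \<open>f\<close>. Fibres of \<open>f\<close>
  are bounded by the lower quasi-isometry bound; fibres of \<open>h\<close> are bounded because all \<open>y\<close> with
  the same \<open>h y\<close> are close to the single point \<open>f (h y)\<close>.
\<close>

lemma bijection_near_quasi_isometry:
  assumes bg: "bounded_geometry m" "bounded_geometry m'"
    and ex: "uniformly_expanding m" "uniformly_expanding m'"
    and f: "quasi_isometry m m' f"
  obtains g b where "bij_betw g (mspace m) (mspace m')"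
    "\<And>x. x \<in> mspace m \<Longrightarrow> mdist m' (g x) (f x) \<le> b"
proof -
  obtain C D where CD: "C > 0" "D > 0" and f_in: "f ` mspace m \<subseteq> mspace m'"
    and lower: "\<And>x x'. x \<in> mspace m \<Longrightarrow> x' \<in> mspace m \<Longrightarrow>
        mdist m x x' \<le> C * (mdist m' (f x) (f x') + D)"
    and upper: "\<And>x x'. x \<in> mspace m \<Longrightarrow> x' \<in> mspace m \<Longrightarrow>
        mdist m' (f x) (f x') \<le> C * mdist m x x' + D"
    and dense: "\<And>y. y \<in> mspace m' \<Longrightarrow> \<exists>x\<in>mspace m. mdist m' y (f x) \<le> C"
    using quasi_isometryE[OF f] by metis
  obtain h where h: "\<And>y. y \<in> mspace m' \<Longrightarrow> h y \<in> mspace m \<and> mdist m' y (f (h y)) \<le> C"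
    using dense by metis
  obtain i r where i: "inj_on i (mspace m)" "i ` mspace m \<subseteq> mspace m'"
    "\<And>x. x \<in> mspace m \<Longrightarrow> mdist m' (f x) (i x) \<le> r"
  proof (rule injection_near_finite_to_one_map[OF bg ex(2) f_in])
    show "mdist m x x' \<le> C * D" if "x \<in> mspace m" "x' \<in> mspace m" "f x = f x'" for x x'
    proof -
      have "f x \<in> mspace m'" using that(1) f_in by auto
      then show ?thesis using lower[OF that(1,2)] mdist_self[of "f x" m'] unfolding that(3) by simp
    qed
  qed blast
  obtain j s where j: "inj_on j (mspace m')" "j ` mspace m' \<subseteq> mspace m"
    "\<And>y. y \<in> mspace m' \<Longrightarrow> mdist m (h y) (j y) \<le> s"
  proof (rule injection_near_finite_to_one_map[OF bg(2,1) ex(1)])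
    show "h ` mspace m' \<subseteq> mspace m" using h by auto
    show "mdist m' y y' \<le> 2 * C" if "y \<in> mspace m'" "y' \<in> mspace m'" "h y = h y'" for y y'
    proof -
      have "f (h y) \<in> mspace m'" using h[OF that(1)] f_in by auto
      then show ?thesis
        using mdist_triangle[of y m' "f (h y)" y'] that h[OF that(1)] h[OF that(2)]
          mdist_commute[of m' y' "f (h y)"] by simp
    qed
  qed blast
  have near_j: "mdist m' y (f (j y)) \<le> C + (C * s + D)" if y: "y \<in> mspace m'" for y
  proof -
    have in_m: "h y \<in> mspace m" "j y \<in> mspace m" using y h j by auto
    then have in_m': "f (h y) \<in> mspace m'" "f (j y) \<in> mspace m'" using f_in by auto
    have "mdist m' (f (h y)) (f (j y)) \<le> C * mdist m (h y) (j y) + D" by (rule upper[OF in_m])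
    also have "\<dots> \<le> C * s + D" using j(3)[OF y] CD by simp
    finally show ?thesis using mdist_triangle[OF y in_m'] h[OF y] by linarith
  qed
  obtain g where g: "bij_betw g (mspace m) (mspace m')"
    "\<And>x. x \<in> mspace m \<Longrightarrow> g x = i x \<or> x = j (g x)"
    using Schroeder_Bernstein_pointwise[OF i(1,2) j(1,2)] by blast
  have "mdist m' (g x) (f x) \<le> max r (C + (C * s + D))" if x: "x \<in> mspace m" for x
    using g(2)[OF x]
  proof
    assume "g x = i x"
    then show ?thesis using i(3)[OF x] by (simp add: mdist_commute)
  next
    assume "x = j (g x)"
    then show ?thesis using near_j[of "g x"] bij_betwE[OF g(1)] x by auto
  qed
  then show thesis using that g(1) by blast
qed

text \<open>
  Only pairs of distinct points matter. Their distances, in \<open>m\<close> as well as (by injectivity of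
  \<open>g\<close>) in \<open>m'\<close>, are bounded below by positive constants, so an additive error \<open>E\<close> is at most
  \<open>E / \<epsilon>\<close> times the distance.
\<close>

lemma bilipschitz_equivalence_if_near_quasi_isometry:
  assumes ud: "uniformly_discrete m" "uniformly_discrete m'"
    and f: "quasi_isometry m m' f"
    and g: "bij_betw g (mspace m) (mspace m')"
    and near: "\<And>x. x \<in> mspace m \<Longrightarrow> mdist m' (g x) (f x) \<le> b"
  shows "bilipschitz_equivalence m m' g"
proof -
  obtain C D where CD: "C > 0" "D > 0" and f_in: "f ` mspace m \<subseteq> mspace m'"
    and lower: "\<And>x x'. x \<in> mspace m \<Longrightarrow> x' \<in> mspace m \<Longrightarrow>
        mdist m x x' \<le> C * (mdist m' (f x) (f x') + D)"
    and upper: "\<And>x x'. x \<in> mspace m \<Longrightarrow> x' \<in> mspace m \<Longrightarrow>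
        mdist m' (f x) (f x') \<le> C * mdist m x x' + D"
    using quasi_isometryE[OF f] by metis
  obtain \<epsilon> where \<epsilon>: "\<epsilon> > 0"
    "\<And>x y. x \<in> mspace m \<Longrightarrow> y \<in> mspace m \<Longrightarrow> x \<noteq> y \<Longrightarrow> \<epsilon> \<le> mdist m x y"
    using ud(1) unfolding uniformly_discrete_def by blast
  obtain \<epsilon>' where \<epsilon>': "\<epsilon>' > 0"
    "\<And>x y. x \<in> mspace m' \<Longrightarrow> y \<in> mspace m' \<Longrightarrow> x \<noteq> y \<Longrightarrow> \<epsilon>' \<le> mdist m' x y"
    using ud(2) unfolding uniformly_discrete_def by blast
  define E where "E = D + 2 * \<bar>b\<bar>"
  have E: "E > 0" using CD by (simp add: E_def)
  define L where "L = max (C + E / \<epsilon>) (C * (1 + E / \<epsilon>'))"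
  have "C + E / \<epsilon> > 0" using CD E \<epsilon>(1) by (simp add: add_pos_pos)
  then have L: "L > 0" "C + E / \<epsilon> \<le> L" "C * (1 + E / \<epsilon>') \<le> L"
    by (auto simp: L_def)
  have "1 / L * mdist m x x' \<le> mdist m' (g x) (g x') \<and> mdist m' (g x) (g x') \<le> L * mdist m x x'"
    if x: "x \<in> mspace m" "x' \<in> mspace m" for x x'
  proof (cases "x = x'")
    case True
    then show ?thesis using x bij_betwE[OF g] by (simp add: mdist_self)
  next
    case False
    have g_in: "g x \<in> mspace m'" "g x' \<in> mspace m'" using x bij_betwE[OF g] by auto
    have f_in': "f x \<in> mspace m'" "f x' \<in> mspace m'" using x f_in by auto
    have "g x \<noteq> g x'" using False x g by (auto simp: bij_betw_def inj_on_def)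
    then have disc: "\<epsilon> \<le> mdist m x x'" "\<epsilon>' \<le> mdist m' (g x) (g x')"
      using \<epsilon>(2) \<epsilon>'(2) x g_in False by auto
    have b: "mdist m' (g x) (f x) \<le> \<bar>b\<bar>" "mdist m' (f x') (g x') \<le> \<bar>b\<bar>"
      using near[OF x(1)] near[OF x(2)] by (auto simp: mdist_commute)
    have "mdist m' (g x) (g x') \<le> mdist m' (f x) (f x') + 2 * \<bar>b\<bar>"
      using mdist_triangle[OF g_in(1) f_in'(1) g_in(2)] mdist_triangle[OF f_in' g_in(2)] b by linarith
    also have "\<dots> \<le> C * mdist m x x' + E" using upper[OF x] by (simp add: E_def)
    also have "\<dots> \<le> C * mdist m x x' + E / \<epsilon> * mdist m x x'"
      using disc(1) E \<epsilon>(1) by (simp add: field_simps)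
    also have "\<dots> \<le> L * mdist m x x'"
      using mult_right_mono[OF L(2), of "mdist m x x'"] by (simp only: distrib_right mdist_nonneg)
    finally have 1: "mdist m' (g x) (g x') \<le> L * mdist m x x'" .
    have "mdist m x x' \<le> C * (mdist m' (f x) (f x') + D)" by (rule lower[OF x])
    also have "\<dots> \<le> C * (mdist m' (g x) (g x') + E)"
      using mdist_triangle[OF f_in'(1) g_in(1) f_in'(2)] mdist_triangle[OF g_in f_in'(2)] b
        mdist_commute[of m' "g x" "f x"] mdist_commute[of m' "g x'" "f x'"] CD
      by (intro mult_left_mono) (auto simp: E_def)
    also have "\<dots> \<le> C * (mdist m' (g x) (g x') + E / \<epsilon>' * mdist m' (g x) (g x'))"
      using disc(2) E \<epsilon>'(1) CD by (intro mult_left_mono) (auto simp: field_simps)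
    also have "\<dots> = C * (1 + E / \<epsilon>') * mdist m' (g x) (g x')" by (simp add: algebra_simps)
    also have "\<dots> \<le> L * mdist m' (g x) (g x')" using L(3) by (intro mult_right_mono) auto
    finally have "1 / L * mdist m x x' \<le> mdist m' (g x) (g x')"
      using L(1) by (simp add: field_simps)
    then show ?thesis using 1 by blast
  qed
  then show ?thesis unfolding bilipschitz_equivalence_def using g L(1) by blast
qed

text \<open>
  This passes from a quasi-isometry of geometric realisations to one of vertex sets: \<open>f\<close> may send a
  vertex into the interior of an edge, and its coarse surjectivity may rely on interior points of
  edges.
\<close>

lemma quasi_isometry_submetric:
  assumes f: "quasi_isometry m m' f"
    and S: "S \<subseteq> mspace m" "\<And>x. x \<in> mspace m \<Longrightarrow> \<exists>y\<in>S. mdist m x y \<le> c"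
    and S': "S' \<subseteq> mspace m'" "g ` S \<subseteq> S'"
    and near: "\<And>x. x \<in> S \<Longrightarrow> mdist m' (g x) (f x) \<le> b"
  shows "quasi_isometry (submetric m S) (submetric m' S') g"
proof -
  obtain C D where CD: "C > 0" "D > 0" and f_in: "f ` mspace m \<subseteq> mspace m'"
    and lower: "\<And>x x'. x \<in> mspace m \<Longrightarrow> x' \<in> mspace m \<Longrightarrow>
        mdist m x x' \<le> C * (mdist m' (f x) (f x') + D)"
    and upper: "\<And>x x'. x \<in> mspace m \<Longrightarrow> x' \<in> mspace m \<Longrightarrow>
        mdist m' (f x) (f x') \<le> C * mdist m x x' + D"
    and dense: "\<And>y. y \<in> mspace m' \<Longrightarrow> \<exists>x\<in>mspace m. mdist m' y (f x) \<le> C"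
    using quasi_isometryE[OF f] by metis
  define E where "E = D + 2 * \<bar>b\<bar>"
  \<comment> \<open>One constant must serve as multiplicative constant and as radius of coarse density: a point
    is within \<open>C\<close> of some \<open>f z\<close>, replacing \<open>z\<close> by a point of \<open>S\<close> costs \<open>C * \<bar>c\<bar> + D\<close>, and
    replacing \<open>f\<close> by \<open>g\<close> costs \<open>\<bar>b\<bar>\<close>.\<close>
  define L where "L = C + (C * \<bar>c\<bar> + E)"
  have E: "E > 0" and L: "L > 0" "C \<le> L" using CD by (auto simp: E_def L_def add_pos_nonneg)
  have g_in: "g x \<in> mspace m'" and f_in': "f x \<in> mspace m'" and b: "mdist m' (g x) (f x) \<le> \<bar>b\<bar>"
    if "x \<in> S" for x
    using subsetD[OF S(1) that] that S' f_in near[OF that] by auto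
  have "1 / L * mdist m x x' - E \<le> mdist m' (g x) (g x') \<and>
      mdist m' (g x) (g x') \<le> L * mdist m x x' + E" if x: "x \<in> S" "x' \<in> S" for x x'
  proof
    have xm: "x \<in> mspace m" "x' \<in> mspace m" using x S by auto
    have b': "mdist m' (f x) (g x) \<le> \<bar>b\<bar>" "mdist m' (f x') (g x') \<le> \<bar>b\<bar>"
      using b x by (auto simp: mdist_commute)
    have "mdist m' (g x) (g x') \<le> mdist m' (f x) (f x') + 2 * \<bar>b\<bar>"
      using mdist_triangle[OF g_in[OF x(1)] f_in'[OF x(1)] g_in[OF x(2)]]
        mdist_triangle[OF f_in'[OF x(1)] f_in'[OF x(2)] g_in[OF x(2)]] b[OF x(1)] b' by linarith
    also have "\<dots> \<le> C * mdist m x x' + E" using upper[OF xm] by (simp add: E_def)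
    also have "\<dots> \<le> L * mdist m x x' + E" using L(2) by (simp add: mult_right_mono)
    finally show "mdist m' (g x) (g x') \<le> L * mdist m x x' + E" .
    have "mdist m x x' \<le> C * (mdist m' (f x) (f x') + D)" by (rule lower[OF xm])
    also have "\<dots> \<le> C * (mdist m' (g x) (g x') + E)"
      using mdist_triangle[OF f_in'[OF x(1)] g_in[OF x(1)] f_in'[OF x(2)]]
        mdist_triangle[OF g_in[OF x(1)] g_in[OF x(2)] f_in'[OF x(2)]] b[OF x(2)] b' CD
      by (intro mult_left_mono) (auto simp: E_def)
    also have "\<dots> \<le> L * (mdist m' (g x) (g x') + E)"
      using L(2) E by (intro mult_right_mono) (auto intro: add_nonneg_nonneg)
    finally show "1 / L * mdist m x x' - E \<le> mdist m' (g x) (g x')"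
      using L(1) by (simp add: field_simps)
  qed
  moreover have "\<exists>x\<in>S. mdist m' y (g x) \<le> L" if y: "y \<in> S'" for y
  proof -
    have ym: "y \<in> mspace m'" using y S' by auto
    obtain z where z: "z \<in> mspace m" "mdist m' y (f z) \<le> C" using dense[OF ym] by blast
    obtain x where x: "x \<in> S" "mdist m z x \<le> \<bar>c\<bar>" using S(2)[OF z(1)] by force
    have xm: "x \<in> mspace m" using x S by auto
    have "mdist m' (f z) (f x) \<le> C * mdist m z x + D" by (rule upper[OF z(1) xm])
    also have "\<dots> \<le> C * \<bar>c\<bar> + D" using x(2) CD by simp
    finally have *: "mdist m' (f z) (f x) \<le> C * \<bar>c\<bar> + D" .
    have fz: "f z \<in> mspace m'" using f_in z(1) by auto
    have "mdist m' y (g x) \<le> L"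
      using mdist_triangle[OF ym fz g_in[OF x(1)]] mdist_triangle[OF fz f_in'[OF x(1)] g_in[OF x(1)]]
        * z(2) b[OF x(1)] mdist_commute[of m' "g x" "f x"] by (simp add: L_def E_def)
    then show ?thesis using x by blast
  qed
  moreover have "mspace m \<inter> S = S" "S \<inter> mspace m = S" "mspace m' \<inter> S' = S'" "S' \<inter> mspace m' = S'"
    using S S' by auto
  ultimately show ?thesis unfolding quasi_isometry_def using S'(2) L(1) E
    by (intro conjI exI[of _ L] exI[of _ E]) auto
qed


section \<open>Vertex sets of graphs\<close>

lemma path_dist_edge_dist_vertex_points:
  assumes "connected_graph G" "x \<in> vertex_points G" "y \<in> vertex_points G"
  obtains u v where "u \<in> verts G" "v \<in> verts G" "x = Vertex u" "y = Vertex v"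
    "path_dist G x y = edge_dist G u v"
  using assms path_dist_Vertex[OF assms(1)] unfolding vertex_points_def by blast

lemma uniformly_discrete_vertex_metric:
  assumes "connected_graph G"
  shows "uniformly_discrete (vertex_metric G)"
proof -
  have "1 \<le> path_dist G x y" if xy: "x \<in> vertex_points G" "y \<in> vertex_points G" "x \<noteq> y" for x y
  proof -
    obtain u v where uv: "u \<in> verts G" "v \<in> verts G" "x = Vertex u" "y = Vertex v"
      "path_dist G x y = edge_dist G u v"
      using path_dist_edge_dist_vertex_points[OF assms xy(1,2)] .
    have "edge_dist G u v \<noteq> 0"
    proof
      assume "edge_dist G u v = 0"
      then have "u = v" using edge_dist_relpow[OF assms uv(1,2)] by simp
      then show False using uv xy(3) by simp
    qed
    then show ?thesis using uv by simp
  qed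
  then show ?thesis using assms by (auto simp: uniformly_discrete_def intro!: exI[of _ 1])
qed

lemma card_relpow_Image_le:
  fixes r :: "('a \<times> 'a) set"
  assumes "\<And>v. finite (r `` {v}) \<and> card (r `` {v}) \<le> k"
  shows "finite ((r ^^ n) `` {u}) \<and> card ((r ^^ n) `` {u}) \<le> k ^ n"
proof (induction n)
  case (Suc n)
  have eq: "(r ^^ Suc n) `` {u} = (\<Union>v\<in>(r ^^ n) `` {u}. r `` {v})" by auto
  have "card ((r ^^ Suc n) `` {u}) \<le> (\<Sum>v\<in>(r ^^ n) `` {u}. card (r `` {v}))"
    unfolding eq using Suc by (intro card_UN_le) simp
  also have "\<dots> \<le> (\<Sum>v\<in>(r ^^ n) `` {u}. k)" by (intro sum_mono) (use assms in simp)
  also have "\<dots> \<le> k ^ Suc n" using Suc by simp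
  finally show ?case unfolding eq using Suc assms by blast
qed simp

text \<open>
  A vertex with at most \<open>\<mu>\<close> incident edges has at most \<open>2 * \<mu>\<close> neighbours when all tails and heads
  of these edges are counted, and the ball of radius \<open>r\<close> is reached by walks of length at most
  \<open>\<lfloor>r\<rfloor>\<close>.
\<close>

lemma bounded_geometry_vertex_metric:
  assumes G: "connected_graph G" and deg: "bounded_degree G"
  shows "bounded_geometry (vertex_metric G)"
  unfolding bounded_geometry_def
proof
  fix r :: real
  have wf: "wf_digraph G" using G by (simp add: connected_graph_def)
  obtain \<mu> :: real where \<mu>: "\<And>v. v \<in> verts G \<Longrightarrow>
      finite {e \<in> arcs G. tail G e = v \<or> head G e = v} \<and>
      card {e \<in> arcs G. tail G e = v \<or> head G e = v} \<le> \<mu>"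
    using deg unfolding bounded_degree_def by blast
  define k where "k = 2 * nat \<lceil>\<mu>\<rceil>"
  have adj: "finite (adj G `` {v}) \<and> card (adj G `` {v}) \<le> k" for v
  proof (cases "v \<in> verts G")
    case True
    let ?E = "{e \<in> arcs G. tail G e = v \<or> head G e = v}"
    have E: "finite ?E" "card ?E \<le> nat \<lceil>\<mu>\<rceil>" using \<mu>[OF True] by linarith+
    have sub: "adj G `` {v} \<subseteq> tail G ` ?E \<union> head G ` ?E"
      by (auto simp: parcs_mk_symmetric)
    have "card (adj G `` {v}) \<le> card (tail G ` ?E \<union> head G ` ?E)"
      using sub E by (intro card_mono) auto
    also have "\<dots> \<le> card (tail G ` ?E) + card (head G ` ?E)" by (rule card_Un_le)
    also have "\<dots> \<le> k"
      using card_image_le[OF E(1), of "tail G"] card_image_le[OF E(1), of "head G"] E(2)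
      by (simp add: k_def)
    finally show ?thesis using finite_subset[OF sub] E by auto
  next
    case False
    then have "adj G `` {v} = {}"
      using wf_digraph.wellformed[OF wf] by (auto simp: parcs_mk_symmetric)
    then show ?thesis by simp
  qed
  note ball = card_relpow_Image_le[OF adj]
  have "finite (mcball_of (vertex_metric G) x r) \<and>
      card (mcball_of (vertex_metric G) x r) \<le> (\<Sum>n\<le>nat \<lfloor>r\<rfloor>. k ^ n)"
    if x: "x \<in> vertex_points G" for x
  proof -
    obtain u where u: "u \<in> verts G" "x = Vertex u" using x by (auto simp: vertex_points_def)
    let ?U = "\<Union>n\<in>{..nat \<lfloor>r\<rfloor>}. (adj G ^^ n) `` {u}"
    have sub: "mcball_of (vertex_metric G) x r \<subseteq> Vertex ` ?U"
    proof
      fix y assume "y \<in> mcball_of (vertex_metric G) x r"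
      then have y: "y \<in> vertex_points G" "path_dist G x y \<le> r" using G by auto
      then obtain v where v: "v \<in> verts G" "y = Vertex v" by (auto simp: vertex_points_def)
      have "edge_dist G u v \<le> nat \<lfloor>r\<rfloor>"
        using y path_dist_Vertex[OF G u(1) v(1)] u v by (simp add: le_nat_floor)
      then show "y \<in> Vertex ` ?U" using edge_dist_relpow[OF G u(1) v(1)] v by auto
    qed
    have fin: "finite ?U" using ball by blast
    have "card (mcball_of (vertex_metric G) x r) \<le> card (Vertex ` ?U :: ('a, 'b) point set)"
      using sub fin by (intro card_mono) auto
    also have "\<dots> \<le> card ?U" by (rule card_image_le[OF fin])
    also have "\<dots> \<le> (\<Sum>n\<le>nat \<lfloor>r\<rfloor>. card ((adj G ^^ n) `` {u}))" by (rule card_UN_le) simp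
    also have "\<dots> \<le> (\<Sum>n\<le>nat \<lfloor>r\<rfloor>. k ^ n)" using ball by (intro sum_mono) auto
    finally show ?thesis using finite_subset[OF sub] fin by auto
  qed
  then show "\<exists>N. \<forall>x\<in>mspace (vertex_metric G). finite (mcball_of (vertex_metric G) x r) \<and>
      card (mcball_of (vertex_metric G) x r) \<le> N"
    using G by auto
qed

text \<open>
  Finiteness of \<open>A\<close> makes the infimum in the definition of the boundary a minimum, and the infimum
  \<open>\<infinity>\<close> over the empty set makes the boundary of the empty set empty.
\<close>

lemma boundary_subset_thickening:
  assumes G: "connected_graph G" and A: "A \<subseteq> vertex_points G" "finite A"
  shows "boundary G A \<subseteq> thickening (vertex_metric G) 1 A"
proof
  fix x assume "x \<in> boundary G A"
  then have x: "x \<in> vertex_points G" "(INF a\<in>A. ereal (path_dist G x a)) \<le> 1"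
    using G by (auto simp: boundary_def)
  have "A \<noteq> {}" using x(2) by (auto simp: top_ereal_def)
  then have "(INF a\<in>A. ereal (path_dist G x a)) \<in> (\<lambda>a. ereal (path_dist G x a)) ` A"
    using A(2) Min_in[of "(\<lambda>a. ereal (path_dist G x a)) ` A"] by (simp add: Min_Inf)
  then obtain a where a: "a \<in> A" "path_dist G x a \<le> 1" using x(2) by auto
  then show "x \<in> thickening (vertex_metric G) 1 A"
    using x(1) A(1) G mdist_commute[of "vertex_metric G" x a] by (auto simp: in_thickening)
qed

text \<open>
  The 1-neighbourhood of \<open>A\<close> contains the disjoint union of \<open>A\<close> and its boundary, and the latter
  has at least \<open>card A / C\<close> elements. Bounded degree makes the boundary finite, which the
  isoperimetric inequality presupposes.
\<close>

lemma uniformly_expanding_vertex_metric: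
  assumes G: "connected_graph G" and deg: "bounded_degree G" and iso: "linear_isoperimetric G"
  shows "uniformly_expanding (vertex_metric G)"
proof -
  note bg = bounded_geometry_vertex_metric[OF G deg]
  obtain C :: real where C: "C > 0" "\<And>A. A \<subseteq> vertex_points G \<Longrightarrow> finite A \<Longrightarrow>
      finite (boundary G A) \<Longrightarrow> card A \<le> C * card (boundary G A)"
    using iso unfolding linear_isoperimetric_def by blast
  show ?thesis
  proof (rule uniformly_expandingI[OF bg, where q = "1 + 1 / C" and r = 1])
    show "1 < 1 + 1 / C" using C by simp
    fix A assume "A \<subseteq> mspace (vertex_metric G)" and fin: "finite A"
    then have A: "A \<subseteq> vertex_points G" using G by simp
    have finT: "finite (thickening (vertex_metric G) 1 A)"
      using bg A fin G by (intro finite_thickening) auto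
    have sub: "boundary G A \<subseteq> thickening (vertex_metric G) 1 A"
      by (rule boundary_subset_thickening[OF G A fin])
    have "A \<subseteq> thickening (vertex_metric G) 1 A"
    proof
      fix a assume a: "a \<in> A"
      then have "mdist (vertex_metric G) a a = 0" using A G by (intro mdist_self) auto
      then show "a \<in> thickening (vertex_metric G) 1 A" using a A G by (auto simp: in_thickening)
    qed
    then have "card (A \<union> boundary G A) \<le> card (thickening (vertex_metric G) 1 A)"
      using sub finT by (intro card_mono) auto
    moreover have "card (A \<union> boundary G A) = card A + card (boundary G A)"
      using fin finite_subset[OF sub finT] by (intro card_Un_disjoint) (auto simp: boundary_def)
    moreover have "card A / C \<le> card (boundary G A)"
      using C(2)[OF A fin finite_subset[OF sub finT]] C(1) by (simp add: field_simps)
    ultimately show "(1 + 1 / C) * card A \<le> card (thickening (vertex_metric G) 1 A)"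
      by (simp add: distrib_right)
  qed
qed

lemma vertex_near_point:
  assumes G: "connected_graph G" and p: "p \<in> points G"
  shows "\<exists>q\<in>vertex_points G. path_dist G p q \<le> 1"
  using p
proof (cases rule: points_cases)
  case (1 v)
  then have "p \<in> vertex_points G" by (simp add: vertex_points_def)
  moreover have "path_dist G p p = 0"
    using Metric_space.mdist_zero[OF Metric_space_path_dist[OF G] p] .
  ultimately show ?thesis by force
next
  case (2 e t)
  have wf: "wf_digraph G" using G by (simp add: connected_graph_def)
  have "path_of_length G (edge_point G e t) (edge_point G e 0) \<bar>t - 0\<bar>"
    using 2 by (intro path_of_length_segment wf) auto
  then have "path_dist G p (Vertex (tail G e)) \<le> t"
    using path_dist_le[OF wf] 2 by (fastforce simp: edge_point_def)
  then show ?thesis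
    using wf_digraph.tail_in_verts[OF wf 2(1)] 2(3)
    by (intro bexI[of _ "Vertex (tail G e)"]) (auto simp: vertex_points_def)
qed

theorem bilipschitz_near_quasi_isometry_of_graphs:
  assumes X: "connected_graph X" "bounded_degree X" "linear_isoperimetric X"
    and Y: "connected_graph Y" "bounded_degree Y" "linear_isoperimetric Y"
    and f: "quasi_isometry (graph_metric X) (graph_metric Y) f"
  obtains g where "bilipschitz_equivalence (vertex_metric X) (vertex_metric Y) g"
    "bdd_above ((\<lambda>v. mdist (graph_metric Y) (g v) (f v)) ` mspace (vertex_metric X))"
proof -
  have sub: "vertex_points X \<subseteq> points X" "vertex_points Y \<subseteq> points Y" by (auto simp: points_def)
  have f_in: "f x \<in> points Y" if "x \<in> vertex_points X" for x
    using f that sub X(1) Y(1) by (auto simp: quasi_isometry_def)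
  obtain rd where rd: "\<And>p. p \<in> points Y \<Longrightarrow> rd p \<in> vertex_points Y \<and> path_dist Y p (rd p) \<le> 1"
    using vertex_near_point[OF Y(1)] by metis
  have near: "mdist (graph_metric Y) (rd (f x)) (f x) \<le> 1" if "x \<in> vertex_points X" for x
    using rd[OF f_in[OF that]] Y(1) mdist_commute[of "graph_metric Y" "f x"] by simp
  have qi: "quasi_isometry (vertex_metric X) (vertex_metric Y) (rd \<circ> f)"
    unfolding vertex_metric_def
    using X(1) Y(1) sub rd f_in near vertex_near_point[OF X(1)]
    by (intro quasi_isometry_submetric[OF f, where b = 1 and c = 1]) auto
  obtain g b where g: "bij_betw g (mspace (vertex_metric X)) (mspace (vertex_metric Y))"
    "\<And>x. x \<in> mspace (vertex_metric X) \<Longrightarrow> mdist (vertex_metric Y) (g x) ((rd \<circ> f) x) \<le> b"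
    using bijection_near_quasi_isometry[OF bounded_geometry_vertex_metric[OF X(1,2)]
        bounded_geometry_vertex_metric[OF Y(1,2)] uniformly_expanding_vertex_metric[OF X]
        uniformly_expanding_vertex_metric[OF Y] qi] by blast
  have "mdist (graph_metric Y) (g x) (f x) \<le> b + 1" if x: "x \<in> mspace (vertex_metric X)" for x
  proof -
    have x': "x \<in> vertex_points X" using x X(1) by simp
    have "g x \<in> points Y" "rd (f x) \<in> points Y"
      using bij_betwE[OF g(1)] x rd[OF f_in[OF x']] sub Y(1) by auto
    then show ?thesis
      using mdist_triangle[of "g x" "graph_metric Y" "rd (f x)" "f x"] f_in[OF x'] near[OF x']
        g(2)[OF x] Y(1) by simp
  qed
  then have "bdd_above ((\<lambda>v. mdist (graph_metric Y) (g v) (f v)) ` mspace (vertex_metric X))"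
    by (intro bdd_aboveI2)
  moreover have "bilipschitz_equivalence (vertex_metric X) (vertex_metric Y) g"
    by (rule bilipschitz_equivalence_if_near_quasi_isometry[OF
          uniformly_discrete_vertex_metric[OF X(1)] uniformly_discrete_vertex_metric[OF Y(1)] qi g])
  ultimately show thesis by (intro that)
qed

theorem theorem1p1:
  fixes X :: "('v, 'e) pre_digraph" and Y :: "('w, 'k) pre_digraph"
  assumes "connected_graph X" and "connected_graph Y"
    and "quasi_isometric (graph_metric X) (graph_metric Y)"
    and "bounded_degree X" and "bounded_degree Y"
    and "linear_isoperimetric X" and "linear_isoperimetric Y"
  shows "bilipschitz_equivalent (vertex_metric X) (vertex_metric Y) \<and>
    (\<forall>f. quasi_isometry (graph_metric X) (graph_metric Y) f \<longrightarrow>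
      (\<exists>g. bilipschitz_equivalence (vertex_metric X) (vertex_metric Y) g \<and>
           bdd_above ((\<lambda>v. mdist (graph_metric Y) (g v) (f v)) ` mspace (vertex_metric X))))"
proof -
  have "\<exists>g. bilipschitz_equivalence (vertex_metric X) (vertex_metric Y) g \<and>
      bdd_above ((\<lambda>v. mdist (graph_metric Y) (g v) (f v)) ` mspace (vertex_metric X))"
    if "quasi_isometry (graph_metric X) (graph_metric Y) f" for f
    by (rule bilipschitz_near_quasi_isometry_of_graphs[OF assms(1,4,6,2,5,7) that]) (intro exI conjI)
  then show ?thesis
    using assms(3) unfolding quasi_isometric_def bilipschitz_equivalent_def by blast
qed

end
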